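(* Let $\mathfrak A$ be an atomic relation algebra. Then the following are equivalent: (i) $\mathfrak A$ is pair-dense; (ii) $\mathfrak A$ is measurable and all the associated groups $G_x$ ($x$ a measurable atom) are cyclic of order $\le 2$.
   Context: A relation algebra is an algebra $\mathfrak A=(A,+,-,;,{}^{\smile},1')$ such that $(A,+,-)$ is a Boolean algebra (with unit $1$, zero $0$, meet $\cdot$ and order $\le$) and, for all $r,s,t\in A$: $r;(s;t)=(r;s);t$, $r;1'=r$, $r^{\smile\smile}=r$, $(r;s)^{\smile}=s^{\smile};r^{\smile}$, $(r+s);t=r;t+s;t$, $(r+s)^{\smile}=r^{\smile}+s^{\smile}$, and $r^{\smile};-(r;s)\le -s$. "Sum" of a set of elements means its supremum. Put $0'=-1'$. An element $x$ is a pair if $x\neq 0$ and $x;0';x;0';x\le 1'$. $\mathfrak A$ is pair-dense if $1'$ is a sum of pairs. An element $f$ is functional if $f^{\smile};f\le 1'$. A subidentity atom is an atom $x\le 1'$. A subidentity atom $x$ is measurable (a measurable atom) if $x;1;x$ is the sum of a set of functional elements. $\mathfrak A$ is measurable if $1'$ is the sum of measurable atoms. For a measurable atom $x$, $G_x$ denotes the set of non-zero functional elements below $x;1;x$; these are atoms and form a group under $;$, with inverse ${}^{\smile}$ and identity element $x$. *)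

theory Defs
  imports "HOL-Library.Lub_Glb" "HOL-Algebra.Elementary_Groups"
begin

hide_const (open) Order.top

text \<open>
  The Boolean part is the library class \<^class>\<open>boolean_algebra\<close>: the operations \<open>+\<close>, \<open>\<cdot>\<close>, \<open>-\<close>
  and the constants \<open>0\<close>, \<open>1\<close> are \<^const>\<open>sup\<close>, \<^const>\<open>inf\<close>, \<^const>\<open>uminus\<close>, \<^const>\<open>bot\<close>, \<^const>\<open>top\<close>.
  The degenerate case \<open>0 = 1\<close> is allowed.
\<close>

class relation_algebra = boolean_algebra +
  fixes rcomp :: "'a \<Rightarrow> 'a \<Rightarrow> 'a" (infixl \<open>\<Zcomp>\<close> 75)
    and conv :: "'a \<Rightarrow> 'a" (\<open>_\<^sup>\<smile>\<close> [1000] 1000)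
    and ident :: "'a" (\<open>1''\<close>)
  assumes rcomp_assoc: "r \<Zcomp> (s \<Zcomp> t) = (r \<Zcomp> s) \<Zcomp> t"
    and rcomp_ident: "r \<Zcomp> 1' = r"
    and conv_conv: "(r\<^sup>\<smile>)\<^sup>\<smile> = r"
    and conv_rcomp: "(r \<Zcomp> s)\<^sup>\<smile> = s\<^sup>\<smile> \<Zcomp> r\<^sup>\<smile>"
    and sup_rcomp: "sup r s \<Zcomp> t = sup (r \<Zcomp> t) (s \<Zcomp> t)"
    and conv_sup: "(sup r s)\<^sup>\<smile> = sup (r\<^sup>\<smile>) (s\<^sup>\<smile>)"
    and conv_rcomp_compl: "r\<^sup>\<smile> \<Zcomp> - (r \<Zcomp> s) \<le> - s"

abbreviation diversity :: "'a::relation_algebra" (\<open>0''\<close>)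
  where "0' \<equiv> - 1'"

definition atom :: "'a::relation_algebra \<Rightarrow> bool"
  where "atom x \<longleftrightarrow> x \<noteq> bot \<and> (\<forall>y. y \<le> x \<longrightarrow> y = bot \<or> y = x)"

definition atomic :: "'a::relation_algebra itself \<Rightarrow> bool"
  where "atomic _ \<longleftrightarrow> (\<forall>y::'a. y \<noteq> bot \<longrightarrow> (\<exists>x. atom x \<and> x \<le> y))"

text \<open>
  Suprema need not exist in general, so ``\<open>s\<close> is the sum of \<open>X\<close>'' is \<^term>\<open>isLub UNIV X s\<close>.
\<close>

definition is_pair :: "'a::relation_algebra \<Rightarrow> bool"
  where "is_pair x \<longleftrightarrow> x \<noteq> bot \<and> x \<Zcomp> 0' \<Zcomp> x \<Zcomp> 0' \<Zcomp> x \<le> 1'"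

definition pair_dense :: "'a::relation_algebra itself \<Rightarrow> bool"
  where "pair_dense _ \<longleftrightarrow> (\<exists>X::'a set. (\<forall>x\<in>X. is_pair x) \<and> isLub UNIV X 1')"

definition functional :: "'a::relation_algebra \<Rightarrow> bool"
  where "functional f \<longleftrightarrow> f\<^sup>\<smile> \<Zcomp> f \<le> 1'"

definition measurable_atom :: "'a::relation_algebra \<Rightarrow> bool"
  where "measurable_atom x \<longleftrightarrow> atom x \<and> x \<le> 1' \<and>
    (\<exists>F. (\<forall>f\<in>F. functional f) \<and> isLub UNIV F (x \<Zcomp> top \<Zcomp> x))"

definition measurable_algebra :: "'a::relation_algebra itself \<Rightarrow> bool"
  where "measurable_algebra _ \<longleftrightarrow> (\<exists>X::'a set. (\<forall>x\<in>X. measurable_atom x) \<and> isLub UNIV X 1')"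

definition atom_group :: "'a::relation_algebra \<Rightarrow> 'a monoid" (\<open>G\<^bsub>_\<^esub>\<close>)
  where "G\<^bsub>x\<^esub> = \<lparr>carrier = {f. f \<noteq> bot \<and> functional f \<and> f \<le> x \<Zcomp> top \<Zcomp> x},
    mult = (\<Zcomp>), one = x\<rparr>"


text \<open>The rest verifies that \<^term>\<open>atom_group x\<close> is indeed a group for a measurable atom \<open>x\<close>.\<close>

context relation_algebra
begin

lemma conv_mono: "r \<le> s \<Longrightarrow> r\<^sup>\<smile> \<le> s\<^sup>\<smile>"
  by (metis conv_sup le_iff_sup)

lemma rcomp_sup: "t \<Zcomp> sup r s = sup (t \<Zcomp> r) (t \<Zcomp> s)"
  by (metis conv_conv conv_rcomp conv_sup sup_rcomp)

lemma rcomp_mono: "r \<le> r' \<Longrightarrow> s \<le> s' \<Longrightarrow> r \<Zcomp> s \<le> r' \<Zcomp> s'"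
proof -
  assume "r \<le> r'" "s \<le> s'"
  then have "r \<Zcomp> s \<le> r' \<Zcomp> s" "r' \<Zcomp> s \<le> r' \<Zcomp> s'"
    by (simp_all add: le_iff_sup flip: sup_rcomp rcomp_sup)
  then show ?thesis by (rule order_trans)
qed

lemma conv_ident: "1'\<^sup>\<smile> = 1'"
  by (metis conv_conv conv_rcomp rcomp_ident)

lemma ident_rcomp: "1' \<Zcomp> r = r"
  by (metis conv_conv conv_rcomp rcomp_ident conv_ident)

lemma conv_bot: "bot\<^sup>\<smile> = bot"
  by (metis bot_least conv_conv conv_mono le_bot)

lemma rcomp_bot: "r \<Zcomp> bot = bot"
proof -
  have "r \<Zcomp> bot \<le> r\<^sup>\<smile>\<^sup>\<smile> \<Zcomp> - (r\<^sup>\<smile> \<Zcomp> top)"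
    by (simp add: conv_conv rcomp_mono)
  also have "\<dots> \<le> - top" by (rule conv_rcomp_compl)
  finally show ?thesis by (simp add: le_bot)
qed

lemma modular: "inf (r \<Zcomp> s) t \<le> r \<Zcomp> inf s (r\<^sup>\<smile> \<Zcomp> t)"
proof -
  let ?u = "r\<^sup>\<smile> \<Zcomp> t"
  have s: "s = sup (inf s ?u) (inf s (- ?u))"
    by (simp flip: inf_sup_distrib1)
  have "r \<Zcomp> inf s (- ?u) \<le> r\<^sup>\<smile>\<^sup>\<smile> \<Zcomp> - ?u"
    by (simp add: conv_conv rcomp_mono)
  also have "\<dots> \<le> - t" by (rule conv_rcomp_compl)
  finally have "r \<Zcomp> s \<le> sup (r \<Zcomp> inf s ?u) (- t)"
    by (metis s rcomp_sup sup_mono order_refl)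
  then have "inf (r \<Zcomp> s) t \<le> inf (sup (r \<Zcomp> inf s ?u) (- t)) t"
    using inf_mono by blast
  also have "\<dots> \<le> r \<Zcomp> inf s ?u" by (simp add: inf_sup_distrib2)
  finally show ?thesis .
qed

lemma le_rcomp_conv_rcomp: "r \<le> r \<Zcomp> r\<^sup>\<smile> \<Zcomp> r"
proof -
  have "r \<le> r \<Zcomp> inf 1' (r\<^sup>\<smile> \<Zcomp> r)" using modular[of r "1'" r] by (simp add: rcomp_ident)
  also have "\<dots> \<le> r \<Zcomp> (r\<^sup>\<smile> \<Zcomp> r)" by (rule rcomp_mono) auto
  finally show ?thesis by (simp add: rcomp_assoc)
qed

lemma conv_subident: assumes "x \<le> 1'" shows "x\<^sup>\<smile> = x"
proof -
  have a: "y \<le> y\<^sup>\<smile>" if "y \<le> 1'" for y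
  proof -
    have "y \<le> y \<Zcomp> y\<^sup>\<smile> \<Zcomp> y" by (rule le_rcomp_conv_rcomp)
    also have "\<dots> \<le> 1' \<Zcomp> y\<^sup>\<smile> \<Zcomp> 1'" by (intro rcomp_mono that order_refl)
    finally show ?thesis by (simp add: rcomp_ident ident_rcomp)
  qed
  show ?thesis using a[OF assms] conv_mono[OF a[OF assms]] by (simp add: conv_conv antisym)
qed

lemma rcomp_subident: assumes "x \<le> 1'" shows "x \<Zcomp> x = x"
proof (rule order.antisym)
  show "x \<Zcomp> x \<le> x" using rcomp_mono[OF assms order_refl[of x]] by (simp add: ident_rcomp)
  have "x \<le> x \<Zcomp> x \<Zcomp> x" using le_rcomp_conv_rcomp[of x] assms by (simp add: conv_subident)
  also have "\<dots> \<le> x \<Zcomp> x \<Zcomp> 1'" by (intro rcomp_mono assms order_refl)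
  finally show "x \<le> x \<Zcomp> x" by (simp add: rcomp_ident)
qed

lemma subident_rcomp_absorb:
  assumes "x \<le> 1'" "f \<le> x \<Zcomp> top"
  shows "x \<Zcomp> f = f"
proof (rule order.antisym)
  show "x \<Zcomp> f \<le> f" using rcomp_mono[OF assms(1) order_refl[of f]] by (simp add: ident_rcomp)
  have "f \<le> x \<Zcomp> inf top (x\<^sup>\<smile> \<Zcomp> f)" using modular[of x top f] assms(2) by (simp add: inf_absorb2)
  also have "\<dots> = x \<Zcomp> x \<Zcomp> f" using assms(1) by (simp add: conv_subident rcomp_assoc)
  finally show "f \<le> x \<Zcomp> f" using assms(1) by (simp add: rcomp_subident)
qed

lemma subident_square_absorb:
  assumes "x \<le> 1'"
  shows "f \<le> x \<Zcomp> top \<Zcomp> x \<longleftrightarrow> x \<Zcomp> f = f \<and> f \<Zcomp> x = f"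
proof safe
  assume f: "f \<le> x \<Zcomp> top \<Zcomp> x"
  have "f \<le> x \<Zcomp> top"
    using f rcomp_mono[OF order_refl[of x] top_greatest[of "top \<Zcomp> x"]]
    by (simp add: rcomp_assoc)
  then show "x \<Zcomp> f = f" by (rule subident_rcomp_absorb[OF assms])
  have "f \<le> top \<Zcomp> x"
    using f rcomp_mono[OF top_greatest[of "x \<Zcomp> top"] order_refl[of x]] by simp
  then have "f\<^sup>\<smile> \<le> (top \<Zcomp> x)\<^sup>\<smile>" by (rule conv_mono)
  also have "\<dots> \<le> x \<Zcomp> top" using assms by (simp add: conv_rcomp conv_subident rcomp_mono)
  finally have "x \<Zcomp> f\<^sup>\<smile> = f\<^sup>\<smile>" by (rule subident_rcomp_absorb[OF assms])
  then show "f \<Zcomp> x = f" by (metis assms conv_conv conv_rcomp conv_subident)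
next
  assume "x \<Zcomp> f = f" "f \<Zcomp> x = f"
  then have "f = x \<Zcomp> f \<Zcomp> x" by simp
  also have "\<dots> \<le> x \<Zcomp> top \<Zcomp> x" by (intro rcomp_mono order_refl top_greatest)
  finally show "f \<le> x \<Zcomp> top \<Zcomp> x" .
qed

end

lemma atom_group_carrier_iff:
  assumes "atom x" "x \<le> 1'"
  shows "f \<in> carrier (atom_group x) \<longleftrightarrow> x \<Zcomp> f = f \<and> f \<Zcomp> x = f \<and> f\<^sup>\<smile> \<Zcomp> f = x"
proof
  assume "f \<in> carrier (atom_group x)"
  then have f: "f \<noteq> bot" "f\<^sup>\<smile> \<Zcomp> f \<le> 1'" "f \<le> x \<Zcomp> top \<Zcomp> x"
    by (auto simp: atom_group_def functional_def)
  have xf: "x \<Zcomp> f = f" "f \<Zcomp> x = f" using f(3) assms(2) by (simp_all add: subident_square_absorb)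
  have "f\<^sup>\<smile> \<Zcomp> f = f\<^sup>\<smile> \<Zcomp> f \<Zcomp> x" by (simp add: xf flip: rcomp_assoc)
  also have "\<dots> \<le> 1' \<Zcomp> x" by (intro rcomp_mono f(2) order_refl)
  finally have le: "f\<^sup>\<smile> \<Zcomp> f \<le> x" by (simp add: ident_rcomp)
  have "f\<^sup>\<smile> \<Zcomp> f \<noteq> bot"
    using le_rcomp_conv_rcomp[of f] f(1) by (metis bot.extremum_uniqueI rcomp_assoc rcomp_bot)
  with le assms(1) have "f\<^sup>\<smile> \<Zcomp> f = x" by (auto simp: atom_def)
  with xf show "x \<Zcomp> f = f \<and> f \<Zcomp> x = f \<and> f\<^sup>\<smile> \<Zcomp> f = x" by blast
next
  assume "x \<Zcomp> f = f \<and> f \<Zcomp> x = f \<and> f\<^sup>\<smile> \<Zcomp> f = x"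
  then have f: "x \<Zcomp> f = f" "f \<Zcomp> x = f" "f\<^sup>\<smile> \<Zcomp> f = x" by blast+
  moreover have "f \<noteq> bot" using f(3) assms(1) by (auto simp: atom_def rcomp_bot)
  ultimately show "f \<in> carrier (atom_group x)" using assms(2)
    by (simp add: atom_group_def functional_def subident_square_absorb)
qed

lemma atom_group_conv_closed:
  assumes x: "measurable_atom x" and f: "f \<in> carrier (atom_group x)"
  shows "f\<^sup>\<smile> \<in> carrier (atom_group x)"
proof -
  from x obtain F where x': "atom x" "x \<le> 1'"
    and F: "\<And>f. f \<in> F \<Longrightarrow> functional f" "isLub UNIV F (x \<Zcomp> top \<Zcomp> x)"
    by (auto simp: measurable_atom_def)
  note iff = atom_group_carrier_iff[OF x']
  have f': "x \<Zcomp> f = f" "f \<Zcomp> x = f" "f\<^sup>\<smile> \<Zcomp> f = x" using f iff by blast+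
  have c: "x \<Zcomp> f\<^sup>\<smile> = f\<^sup>\<smile>" "f\<^sup>\<smile> \<Zcomp> x = f\<^sup>\<smile>"
    using f' x'(2) by (metis conv_rcomp conv_subident)+
  have ne: "f\<^sup>\<smile> \<noteq> bot" using f by (metis (mono_tags, lifting) atom_group_def conv_bot conv_conv
        mem_Collect_eq partial_object.select_convs(1))
  have le: "f\<^sup>\<smile> \<le> x \<Zcomp> top \<Zcomp> x" using c x'(2) by (simp add: subident_square_absorb)
  obtain g where g: "g \<in> F" "inf (f\<^sup>\<smile>) g \<noteq> bot"
  proof (rule ccontr)
    assume no: "\<not> thesis"
    have "g \<le> - (f\<^sup>\<smile>)" if "g \<in> F" for g
    proof -
      have "inf g (f\<^sup>\<smile>) = bot" using no \<open>\<And>g. \<lbrakk>g \<in> F; inf (f\<^sup>\<smile>) g \<noteq> bot\<rbrakk> \<Longrightarrow> thesis\<close> \<open>g \<in> F\<close>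
        by (auto simp: inf.commute)
      then show ?thesis by (simp add: inf_shunt)
    qed
    then have "x \<Zcomp> top \<Zcomp> x \<le> - (f\<^sup>\<smile>)"
      by (meson F(2) UNIV_I isLub_le_isUb isUbI setleI)
    with le have "f\<^sup>\<smile> \<le> - (f\<^sup>\<smile>)" by (rule order_trans)
    then show False using ne by (metis inf.idem inf_shunt)
  qed
  define h where "h = inf (f\<^sup>\<smile>) g"
  have "h\<^sup>\<smile> \<Zcomp> h \<le> g\<^sup>\<smile> \<Zcomp> g" by (simp add: h_def conv_mono rcomp_mono)
  also have "\<dots> \<le> 1'" using F(1) g(1) by (simp add: functional_def)
  finally have "functional h" by (simp add: functional_def)
  moreover have "h \<le> x \<Zcomp> top \<Zcomp> x" using le by (simp add: h_def le_infI1)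
  ultimately have h: "h \<in> carrier (atom_group x)" using g(2) by (simp add: atom_group_def h_def)
  then have hx: "h\<^sup>\<smile> \<Zcomp> h = x" "x \<Zcomp> h = h" "h \<Zcomp> x = h" using iff by blast+
  have "f = h\<^sup>\<smile> \<Zcomp> (h \<Zcomp> f)" using f' hx by (simp add: rcomp_assoc)
  also have "\<dots> \<le> h\<^sup>\<smile> \<Zcomp> (f\<^sup>\<smile> \<Zcomp> f)" by (intro rcomp_mono order_refl) (simp add: h_def)
  also have "\<dots> = h\<^sup>\<smile>" using f' hx x'(2) by (metis conv_rcomp conv_subident)
  finally have "f\<^sup>\<smile> \<le> h" by (metis conv_conv conv_mono)
  then have "f\<^sup>\<smile> = h" by (simp add: h_def inf.absorb1 antisym)
  with h show ?thesis by simp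
qed

lemma group_atom_group:
  assumes "measurable_atom x"
  shows "group (atom_group x)" and "f \<in> carrier (atom_group x) \<Longrightarrow> inv\<^bsub>atom_group x\<^esub> f = f\<^sup>\<smile>"
proof -
  from assms have x: "atom x" "x \<le> 1'" by (auto simp: measurable_atom_def)
  note iff = atom_group_carrier_iff[OF x]
  have mult: "f \<otimes>\<^bsub>atom_group x\<^esub> g = f \<Zcomp> g" and one: "\<one>\<^bsub>atom_group x\<^esub> = x" for f g
    by (simp_all add: atom_group_def)
  show gr: "group (atom_group x)"
  proof (rule groupI; unfold mult one)
    fix f g assume "f \<in> carrier (atom_group x)" "g \<in> carrier (atom_group x)"
    then have f: "x \<Zcomp> f = f" "f \<Zcomp> x = f" "f\<^sup>\<smile> \<Zcomp> f = x"
      and g: "x \<Zcomp> g = g" "g \<Zcomp> x = g" "g\<^sup>\<smile> \<Zcomp> g = x" using iff by blast+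
    have "(f \<Zcomp> g)\<^sup>\<smile> \<Zcomp> (f \<Zcomp> g) = g\<^sup>\<smile> \<Zcomp> ((f\<^sup>\<smile> \<Zcomp> f) \<Zcomp> g)"
      by (simp add: conv_rcomp rcomp_assoc)
    then have "(f \<Zcomp> g)\<^sup>\<smile> \<Zcomp> (f \<Zcomp> g) = x" using f g by simp
    moreover have "x \<Zcomp> (f \<Zcomp> g) = f \<Zcomp> g" "f \<Zcomp> g \<Zcomp> x = f \<Zcomp> g"
      using f g by (metis rcomp_assoc)+
    ultimately show "f \<Zcomp> g \<in> carrier (atom_group x)" using iff by blast
  next
    show "x \<in> carrier (atom_group x)"
      using x(2) by (simp add: iff conv_subident rcomp_subident)
  next
    fix f assume f: "f \<in> carrier (atom_group x)"
    then show "x \<Zcomp> f = f" using iff by blast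
    show "\<exists>g\<in>carrier (atom_group x). g \<Zcomp> f = x"
      using f atom_group_conv_closed[OF assms] iff by blast
  qed (simp add: rcomp_assoc)
  show "inv\<^bsub>atom_group x\<^esub> f = f\<^sup>\<smile>" if "f \<in> carrier (atom_group x)"
    using that atom_group_conv_closed[OF assms that] iff
    by (intro group.inv_equality[OF gr]) (auto simp: mult one)
qed

end

theory Submission
  imports Defs
begin

text \<open>
  For a subidentity element \<open>x\<close>, the square \<open>x \<Zcomp> top \<Zcomp> x\<close> splits into its identity part \<open>x\<close> and its
  diversity part \<open>d = x \<Zcomp> 0' \<Zcomp> x\<close> (lemma \<open>square_eq_sup_diversity\<close>).  Since \<open>d\<close> is symmetric and
  \<open>d \<Zcomp> d = x \<Zcomp> 0' \<Zcomp> x \<Zcomp> 0' \<Zcomp> x\<close>, a non-zero \<open>x\<close> is a pair exactly when \<open>d\<close> is functional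
  (lemma \<open>is_pair_iff_functional\<close>).  So the equivalence reduces to a local statement about one
  subidentity atom \<open>x\<close>: \<open>d\<close> is functional iff \<open>x\<close> is measurable with a group of order at most two.

  If \<open>d\<close> is functional, then the square is the sum of the two functional elements \<open>x\<close> and \<open>d\<close>; as
  the members of \<open>G\<^bsub>x\<^esub>\<close> are pairwise disjoint, \<open>G\<^bsub>x\<^esub>\<close> can contain nothing but \<open>x\<close> and \<open>d\<close>
  (lemma \<open>atom_group_of_pair\<close>).  Conversely, if \<open>G\<^bsub>x\<^esub>\<close> has at most one member \<open>f\<close> besides the unit
  \<open>x\<close>, then measurability gives that the square lies below \<open>x + f\<close>, hence \<open>d \<le> f\<close>, and \<open>d\<close> inherits
  functionality from \<open>f\<close> (lemma \<open>pair_of_atom_group\<close>).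

  To pass between the local and the global statement: non-zero elements below a pair are pairs, so
  in a pair-dense algebra every subidentity atom is a pair, and in an atomic algebra the
  subidentity atoms add up to \<open>1'\<close>.
\<close>

section \<open>Sums, converse and functional elements\<close>

lemma isLub_overlap:
  fixes s :: "'a::boolean_algebra"
  assumes "isLub UNIV X s" "y \<le> s" "y \<noteq> bot"
  shows "\<exists>x\<in>X. inf y x \<noteq> bot"
proof (rule ccontr)
  assume "\<not> ?thesis"
  then have "x \<le> - y" if "x \<in> X" for x
    using that by (metis inf.commute inf_shunt)
  then have "s \<le> - y"
    using isLub_le_isUb[OF assms(1)] isUb_UNIV_I by blast
  with assms(2) have "y \<le> - y" by (rule order_trans)
  then show False
    using assms(3) by (metis inf.idem inf_shunt)
qed

lemma conv_compl:
  fixes r :: "'a::relation_algebra"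
  shows "(- r)\<^sup>\<smile> = - (r\<^sup>\<smile>)"
proof (rule compl_unique[symmetric])
  let ?m = "inf (r\<^sup>\<smile>) ((- r)\<^sup>\<smile>)"
  \<comment> \<open>Converse is an involutive order automorphism, so it preserves disjointness.\<close>
  have "?m\<^sup>\<smile> \<le> r" "?m\<^sup>\<smile> \<le> - r"
    using conv_mono[of ?m "r\<^sup>\<smile>"] conv_mono[of ?m "(- r)\<^sup>\<smile>"] by (simp_all add: conv_conv)
  then have "?m\<^sup>\<smile> = bot"
    by (metis inf.bounded_iff inf_compl_bot le_bot)
  then show "?m = bot"
    by (metis conv_bot conv_conv)
next
  have "top\<^sup>\<smile> = (top::'a)"
    by (metis conv_conv conv_mono top_greatest top_le)
  then show "sup (r\<^sup>\<smile>) ((- r)\<^sup>\<smile>) = top"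
    by (simp flip: conv_sup)
qed

lemma functional_mono:
  assumes "functional g" "f \<le> g"
  shows "functional f"
proof -
  have "f\<^sup>\<smile> \<Zcomp> f \<le> g\<^sup>\<smile> \<Zcomp> g"
    using assms(2) by (intro rcomp_mono conv_mono)
  with assms(1) show ?thesis
    unfolding functional_def by (meson order_trans)
qed

lemma functional_subident:
  assumes "x \<le> 1'"
  shows "functional x"
  using assms by (simp add: functional_def conv_subident rcomp_subident)

section \<open>Pairs and the diversity part of a square\<close>

lemma square_eq_sup_diversity:
  assumes "x \<le> 1'"
  shows "x \<Zcomp> top \<Zcomp> x = sup x (x \<Zcomp> 0' \<Zcomp> x)"
proof -
  have "x \<Zcomp> top \<Zcomp> x = x \<Zcomp> sup 1' 0' \<Zcomp> x"
    by simp
  also have "\<dots> = sup (x \<Zcomp> 1' \<Zcomp> x) (x \<Zcomp> 0' \<Zcomp> x)"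
    by (simp only: rcomp_sup sup_rcomp)
  finally show ?thesis
    using assms by (simp add: rcomp_ident rcomp_subident)
qed

lemma is_pair_iff_functional:
  assumes "x \<le> 1'"
  shows "is_pair x \<longleftrightarrow> x \<noteq> bot \<and> functional (x \<Zcomp> 0' \<Zcomp> x)"
proof -
  have "(x \<Zcomp> 0' \<Zcomp> x)\<^sup>\<smile> = x \<Zcomp> 0' \<Zcomp> x"
    using assms by (simp add: conv_rcomp conv_compl conv_ident conv_subident rcomp_assoc)
  moreover have "x \<Zcomp> 0' \<Zcomp> x \<Zcomp> (x \<Zcomp> 0' \<Zcomp> x) = x \<Zcomp> 0' \<Zcomp> (x \<Zcomp> x) \<Zcomp> 0' \<Zcomp> x"
    by (simp only: rcomp_assoc)
  ultimately show ?thesis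
    using assms by (simp add: is_pair_def functional_def rcomp_subident)
qed

lemma is_pair_antimono:
  assumes "is_pair x" "y \<le> x" "y \<noteq> bot"
  shows "is_pair y"
proof -
  have "y \<Zcomp> 0' \<Zcomp> y \<Zcomp> 0' \<Zcomp> y \<le> x \<Zcomp> 0' \<Zcomp> x \<Zcomp> 0' \<Zcomp> x"
    by (intro rcomp_mono assms(2) order_refl)
  with assms show ?thesis
    unfolding is_pair_def by (meson order_trans)
qed

section \<open>Groups of order at most two\<close>

lemma (in group) cyclic_group_of_two:
  assumes "a \<in> carrier G" "carrier G \<subseteq> {\<one>, a}"
  shows "cyclic_group G"
proof -
  have "\<one> = a [^] (0::int)" "a = a [^] (1::int)"
    using assms(1) by (simp_all add: int_pow_1)
  then have "carrier G \<subseteq> range (\<lambda>n::int. a [^] n)"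
    using assms(2) by blast
  moreover have "range (\<lambda>n::int. a [^] n) \<subseteq> carrier G"
    using assms(1) by auto
  ultimately show ?thesis
    using assms(1) cyclic_group by blast
qed

text \<open>
  Members of the group behave like graphs of permutations of \<open>x\<close>: the smaller element \<open>g\<close> is already
  defined everywhere on \<open>x\<close>, that is \<open>g \<Zcomp> g\<^sup>\<smile> = x\<close>, which leaves no room for \<open>h\<close> to be larger.
\<close>

lemma atom_group_le_imp_eq:
  assumes x: "measurable_atom x"
    and g: "g \<in> carrier (atom_group x)" and h: "h \<in> carrier (atom_group x)" and "g \<le> h"
  shows "g = h"
proof (rule order.antisym[OF \<open>g \<le> h\<close>])
  from x have "atom x" "x \<le> 1'" by (auto simp: measurable_atom_def)
  note iff = atom_group_carrier_iff[OF this]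
  have gg: "g \<Zcomp> g\<^sup>\<smile> = x"
    using atom_group_conv_closed[OF x g] iff by (metis conv_conv)
  have "h = x \<Zcomp> h"
    using h iff by metis
  also have "\<dots> = g \<Zcomp> (g\<^sup>\<smile> \<Zcomp> h)"
    by (simp add: rcomp_assoc gg)
  also have "\<dots> \<le> g \<Zcomp> (h\<^sup>\<smile> \<Zcomp> h)"
    using \<open>g \<le> h\<close> by (intro rcomp_mono conv_mono order_refl)
  also have "\<dots> = g"
    using g h iff by metis
  finally show "h \<le> g" .
qed

lemma atom_group_disjoint:
  assumes x: "measurable_atom x"
    and g: "g \<in> carrier (atom_group x)" and h: "h \<in> carrier (atom_group x)" and "inf g h \<noteq> bot"
  shows "g = h"
proof -
  have "functional (inf g h)"
    using g functional_mono[of g] by (simp add: atom_group_def)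
  then have "inf g h \<in> carrier (atom_group x)"
    using g \<open>inf g h \<noteq> bot\<close> by (simp add: atom_group_def le_infI1)
  then show ?thesis
    using atom_group_le_imp_eq[OF x] g h by (metis inf.cobounded1 inf.cobounded2)
qed

lemma atom_group_of_pair:
  assumes "atom x" "x \<le> 1'" "is_pair x"
  shows "measurable_atom x"
    and "carrier (atom_group x) \<subseteq> {x, x \<Zcomp> 0' \<Zcomp> x}"
proof -
  let ?d = "x \<Zcomp> 0' \<Zcomp> x"
  note square = square_eq_sup_diversity[OF \<open>x \<le> 1'\<close>]
  have d: "functional ?d"
    using assms is_pair_iff_functional by blast
  have "isLub UNIV {x, ?d} (x \<Zcomp> top \<Zcomp> x)"
    unfolding square
    by (auto simp: isLub_def leastP_def isUb_def setle_def setge_def)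
  with d show m: "measurable_atom x"
    unfolding measurable_atom_def
    using assms(1,2) functional_subident by (intro conjI exI[of _ "{x, ?d}"]) auto
  show "carrier (atom_group x) \<subseteq> {x, ?d}"
  proof
    fix g assume g: "g \<in> carrier (atom_group x)"
    then have "g \<noteq> bot" "g \<le> sup x ?d"
      by (simp_all add: atom_group_def square)
    then have "sup (inf g x) (inf g ?d) \<noteq> bot"
      by (simp add: inf.absorb1 flip: inf_sup_distrib1)
    then consider "inf g x \<noteq> bot" | "inf g ?d \<noteq> bot"
      by fastforce
    then show "g \<in> {x, ?d}"
    proof cases
      case 1
      have "x \<in> carrier (atom_group x)"
        using assms(1,2) by (simp add: atom_group_carrier_iff conv_subident rcomp_subident)
      then show ?thesis
        using atom_group_disjoint[OF m g _ 1] by blast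
    next
      case 2
      \<comment> \<open>If \<open>x\<close> consists of a single point, then \<open>?d\<close> is zero and not in the group;
        the overlap with \<open>g\<close> excludes this.\<close>
      then have "?d \<noteq> bot" by auto
      then have "?d \<in> carrier (atom_group x)"
        using d by (simp add: atom_group_def square)
      then show ?thesis
        using atom_group_disjoint[OF m g _ 2] by blast
    qed
  qed
qed

lemma cyclic_atom_group_of_pair:
  assumes "atom x" "x \<le> 1'" "is_pair x"
  shows "cyclic_group (atom_group x) \<and> finite (carrier (atom_group x)) \<and> order (atom_group x) \<le> 2"
proof -
  let ?d = "x \<Zcomp> 0' \<Zcomp> x"
  note m = atom_group_of_pair(1)[OF assms] and sub = atom_group_of_pair(2)[OF assms]
  interpret G: group "atom_group x"
    using m by (rule group_atom_group)
  have one: "\<one>\<^bsub>atom_group x\<^esub> = x"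
    by (simp add: atom_group_def)
  have "cyclic_group (atom_group x)"
  proof (cases "?d \<in> carrier (atom_group x)")
    case True
    then show ?thesis
      using sub one by (intro G.cyclic_group_of_two) auto
  next
    case False
    then show ?thesis
      using sub one G.one_closed by (intro G.cyclic_group_of_two[of x]) auto
  qed
  moreover have "finite (carrier (atom_group x))"
    using sub finite_subset by blast
  moreover have "order (atom_group x) \<le> card {x, ?d}"
    unfolding order_def using sub by (intro card_mono) auto
  moreover have "card {x, ?d} \<le> 2"
    by (simp add: card_insert_if)
  ultimately show ?thesis
    by linarith
qed

lemma pair_of_atom_group:
  assumes x: "measurable_atom x"
    and fin: "finite (carrier (atom_group x))" and ord: "order (atom_group x) \<le> 2"
  shows "is_pair x"
proof -
  let ?d = "x \<Zcomp> 0' \<Zcomp> x"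
  from x obtain F where "atom x" "x \<le> 1'"
    and F: "\<And>f. f \<in> F \<Longrightarrow> functional f" "isLub UNIV F (x \<Zcomp> top \<Zcomp> x)"
    by (auto simp: measurable_atom_def)
  interpret G: group "atom_group x"
    using x by (rule group_atom_group)
  have xG: "x \<in> carrier (atom_group x)"
    using G.one_closed by (simp add: atom_group_def)
  \<comment> \<open>For the trivial group, \<open>f = x\<close> serves as the second element.\<close>
  obtain f where fG: "f \<in> carrier (atom_group x)" and sub: "carrier (atom_group x) \<subseteq> {x, f}"
  proof (cases "carrier (atom_group x) = {x}")
    case True
    then show thesis using that[of x] by simp
  next
    case False
    then obtain f where f: "f \<in> carrier (atom_group x)" "f \<noteq> x"
      using xG by blast
    then have "{x, f} = carrier (atom_group x)"
      using xG fin ord by (intro card_seteq) (auto simp: order_def)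
    then show thesis
      using that f(1) by blast
  qed
  have "g \<le> sup x f" if "g \<in> F" for g
  proof (cases "g = bot")
    case False
    then have "g \<in> carrier (atom_group x)"
      using F that isLubD2[OF F(2)] by (simp add: atom_group_def)
    then show ?thesis
      using sub by auto
  qed simp
  then have "x \<Zcomp> top \<Zcomp> x \<le> sup x f"
    using isLub_le_isUb[OF F(2)] isUb_UNIV_I by blast
  then have "?d \<le> sup x f"
    using square_eq_sup_diversity[OF \<open>x \<le> 1'\<close>] by simp
  moreover have "?d \<le> - x"
  proof -
    have "?d \<le> 1' \<Zcomp> 0' \<Zcomp> 1'"
      using \<open>x \<le> 1'\<close> by (intro rcomp_mono order_refl)
    also have "\<dots> \<le> - x"
      using \<open>x \<le> 1'\<close> by (simp add: rcomp_ident ident_rcomp)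
    finally show ?thesis .
  qed
  ultimately have "?d \<le> inf (sup x f) (- x)"
    by simp
  then have "?d \<le> f"
    by (simp add: inf_sup_distrib2)
  moreover have "functional f"
    using fG by (simp add: atom_group_def)
  ultimately have "functional ?d"
    by (rule functional_mono[rotated])
  then show ?thesis
    using \<open>atom x\<close> \<open>x \<le> 1'\<close> by (simp add: is_pair_iff_functional atom_def)
qed

section \<open>Pair-density of atomic relation algebras\<close>

lemma pair_dense_subident_atom:
  fixes x :: "'a::relation_algebra"
  assumes "pair_dense TYPE('a)" "atom x" "x \<le> 1'"
  shows "is_pair x"
proof -
  obtain X :: "'a set" where X: "\<And>p. p \<in> X \<Longrightarrow> is_pair p" "isLub UNIV X 1'"
    using assms(1) by (auto simp: pair_dense_def)
  have "x \<noteq> bot"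
    using assms(2) by (simp add: atom_def)
  then obtain p where "p \<in> X" "inf x p \<noteq> bot"
    using isLub_overlap[OF X(2) assms(3)] by blast
  moreover from this have "inf x p = x"
    using assms(2) unfolding atom_def by (meson inf.cobounded1)
  ultimately show ?thesis
    using X(1) is_pair_antimono \<open>x \<noteq> bot\<close> by (metis inf.cobounded2)
qed

lemma atomic_isLub_subident_atoms:
  assumes "atomic TYPE('a::relation_algebra)"
  shows "isLub UNIV {x::'a. atom x \<and> x \<le> 1'} 1'"
proof -
  have "1' \<le> u" if u: "\<And>x::'a. atom x \<Longrightarrow> x \<le> 1' \<Longrightarrow> x \<le> u" for u
  proof (rule ccontr)
    assume "\<not> 1' \<le> u"
    then have "inf 1' (- u) \<noteq> bot"
      by (simp add: inf_shunt)
    then obtain x where "atom x" "x \<le> inf 1' (- u)"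
      using assms unfolding atomic_def by blast
    moreover from this have "x \<le> u" "x \<le> - u"
      using u by auto
    ultimately show False
      unfolding atom_def by (metis inf.bounded_iff inf_compl_bot le_bot)
  qed
  then show ?thesis
    by (auto simp: isLub_def leastP_def isUb_def setle_def setge_def)
qed

theorem lemma5p8:
  assumes "atomic TYPE('a::relation_algebra)"
  shows "pair_dense TYPE('a) \<longleftrightarrow>
    measurable_algebra TYPE('a) \<and>
    (\<forall>x::'a. measurable_atom x \<longrightarrow>
      cyclic_group (atom_group x) \<and> finite (carrier (atom_group x)) \<and> order (atom_group x) \<le> 2)"
    (is "_ \<longleftrightarrow> _ \<and> ?small")
proof
  assume pd: "pair_dense TYPE('a)"
  have "measurable_atom x" if "atom x" "x \<le> 1'" for x :: 'a
    using that pair_dense_subident_atom[OF pd] by (intro atom_group_of_pair(1))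
  then have "measurable_algebra TYPE('a)"
    unfolding measurable_algebra_def using atomic_isLub_subident_atoms[OF assms]
    by (intro exI[of _ "{x. atom x \<and> x \<le> 1'}"]) simp
  moreover have ?small
  proof (intro allI impI)
    fix x :: 'a
    assume "measurable_atom x"
    then have "atom x" "x \<le> 1'"
      by (auto simp: measurable_atom_def)
    then show "cyclic_group (atom_group x) \<and> finite (carrier (atom_group x)) \<and>
        order (atom_group x) \<le> 2"
      using pair_dense_subident_atom[OF pd] by (intro cyclic_atom_group_of_pair)
  qed
  ultimately show "measurable_algebra TYPE('a) \<and> ?small" ..
next
  assume R: "measurable_algebra TYPE('a) \<and> ?small"
  then obtain X :: "'a set" where X: "\<And>x. x \<in> X \<Longrightarrow> measurable_atom x" "isLub UNIV X 1'"
    unfolding measurable_algebra_def by blast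
  have "is_pair x" if "x \<in> X" for x
    using R X(1)[OF that] pair_of_atom_group by blast
  with X(2) show "pair_dense TYPE('a)"
    unfolding pair_dense_def by (intro exI[of _ X]) simp
qed

end
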